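(* For every sequence $(\varepsilon_n)_{n\ge1}$ of positive numbers with $\lim_n\varepsilon_n=0$, there exists a surjective and four-valent analytic map $\varphi\colon\mathbb{D}\to\mathbb{D}$ such that, for some constant $K>0$, $a_n(C_\varphi)\le Ke^{-n\varepsilon_n}$ for all $n\ge1$, where $C_\varphi\colon H^2\to H^2$. Consequently, there exists a surjective and four-valent analytic map $\varphi\colon\mathbb{D}\to\mathbb{D}$ such that $C_\varphi\colon H^2\to H^2$ belongs to every Schatten class $S_p(H^2)$, $p>0$.
   Context: $H^2$ is the Hardy space of the unit disk $\mathbb{D}$, $C_\varphi f=f\circ\varphi$. The approximation numbers are $a_n(T)=\inf\{\|T-R\|:\operatorname{rank}R<n\}$, and $T\in S_p$ means $(a_n(T))_n\in\ell^p$. Four-valent means every point has at most four preimages. *)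

theory Defs
  imports "HOL-Complex_Analysis.Complex_Analysis"
begin

definition taylor_coeff :: "(complex \<Rightarrow> complex) \<Rightarrow> nat \<Rightarrow> complex" where
  "taylor_coeff f k = (deriv ^^ k) f 0 / of_nat (fact k)"

text \<open>Hardy space H^2 of the unit disk: analytic functions with square-summable
  Taylor coefficients (values outside the disk are irrelevant).\<close>
definition H2 :: "(complex \<Rightarrow> complex) set" where
  "H2 = {f. f holomorphic_on ball 0 1 \<and> summable (\<lambda>k. (cmod (taylor_coeff f k))\<^sup>2)}"

definition h2norm :: "(complex \<Rightarrow> complex) \<Rightarrow> real" where
  "h2norm f = sqrt (\<Sum>k. (cmod (taylor_coeff f k))\<^sup>2)"

definition comp_op :: "(complex \<Rightarrow> complex) \<Rightarrow> (complex \<Rightarrow> complex) \<Rightarrow> (complex \<Rightarrow> complex)" where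
  "comp_op \<phi> f = f \<circ> \<phi>"

definition rank_le_op :: "((complex \<Rightarrow> complex) \<Rightarrow> (complex \<Rightarrow> complex)) \<Rightarrow> nat \<Rightarrow> bool" where
  "rank_le_op R m \<longleftrightarrow>
     (\<forall>f\<in>H2. \<forall>g\<in>H2. R (\<lambda>z. f z + g z) = (\<lambda>z. R f z + R g z)) \<and>
     (\<forall>f\<in>H2. \<forall>c. R (\<lambda>z. c * f z) = (\<lambda>z. c * R f z)) \<and>
     (\<exists>g :: nat \<Rightarrow> complex \<Rightarrow> complex. (\<forall>i<m. g i \<in> H2) \<and>
        (\<forall>f\<in>H2. \<exists>c :: nat \<Rightarrow> complex. R f = (\<lambda>z. \<Sum>i<m. c i * g i z)))"

definition approx_num :: "((complex \<Rightarrow> complex) \<Rightarrow> (complex \<Rightarrow> complex)) \<Rightarrow> nat \<Rightarrow> real" where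
  "approx_num T n = Inf {M. M \<ge> 0 \<and> (\<exists>R. rank_le_op R (n - 1) \<and>
        (\<forall>f\<in>H2. h2norm (\<lambda>z. T f z - R f z) \<le> M * h2norm f))}"

definition schatten :: "real \<Rightarrow> ((complex \<Rightarrow> complex) \<Rightarrow> (complex \<Rightarrow> complex)) \<Rightarrow> bool" where
  "schatten p T \<longleftrightarrow> summable (\<lambda>n. (approx_num T (Suc n)) powr p)"

definition surj_four_valent_self_map :: "(complex \<Rightarrow> complex) \<Rightarrow> bool" where
  "surj_four_valent_self_map \<phi> \<longleftrightarrow>
     \<phi> holomorphic_on ball 0 1 \<and> \<phi> ` ball 0 1 = ball 0 1 \<and>
     (\<forall>w. finite {z \<in> ball 0 1. \<phi> z = w} \<and> card {z \<in> ball 0 1. \<phi> z = w} \<le> 4)"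

end

theory Submission
  imports Defs "HOL-Real_Asymp.Real_Asymp"
begin

text \<open>
  If \<open>|\<phi>|^(2N) / (1 - |\<phi>|\<^sup>2)\<close> is dominated on the disk by \<open>M\<^sup>2\<close> times a positive harmonic
  function \<open>Re h\<close>, then Cauchy-Schwarz applied to the Taylor tail of \<open>f\<close> shows that truncating the
  Taylor series after \<open>N\<close> terms approximates the composition operator up to \<open>M * sqrt (Re (h 0))\<close>.

  For a decreasing bijection \<open>g\<close> from the reals to the positive reals, let \<open>f\<close> be a Riemann map
  onto the domain between the graph of \<open>g\<close> (as a function of the imaginary part) and its
  translate by \<open>4\<pi>\<close>. Each horizontal line meets this domain in an interval and each vertical line
  in an interval of length \<open>4\<pi>\<close>, so \<open>exp (-f)\<close> maps the disk onto the punctured disk, at most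
  two-to-one. Composing with the Blaschke product with zeros 0 and 1/2 gives a surjective
  four-valent map.
  Far up in the domain \<open>Re exp (-\<i>w)\<close> is comparable to \<open>exp (Im w)\<close>, hence the part of the
  circle where \<open>Im f > y\<close> has measure \<open>O(exp (-y))\<close>, and letting \<open>g\<close> tend to 0 slowly makes
  \<open>\<phi>\<close> approach the unit circle only on extremely small sets.
\<close>

section \<open>Taylor coefficients as circle means\<close>

text \<open>On the circle of radius \<open>r\<close> the conjugate of \<open>z\<close> is
  \<open>r^2 / z\<close>, which turns the integrand into a multiple of the one in Cauchy's formula
  for the \<open>j\<close>-th derivative. Since \<open>circlepath\<close> runs over
  \<open>{0..1}\<close>, the integral is a mean value.\<close>

lemma circle_mean_coeff:
  assumes F: "F holomorphic_on ball 0 1" and r: "0 < r" "r < 1"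
  shows "((\<lambda>t. F (circlepath 0 r t) * cnj (circlepath 0 r t) ^ j) has_integral
           taylor_coeff F j * of_real (r ^ (2 * j))) {0..1}"
proof -
  let ?E = "circlepath 0 r"
  have E: "?E t = of_real r * exp (2 * of_real pi * \<i> * of_real t)" for t
    by (simp add: circlepath)
  have E0: "?E t \<noteq> 0" for t
    using r by (simp add: E)
  have nE: "cmod (?E t) = r" for t
    using r by (simp add: E norm_mult norm_exp_eq_Re)
  have cE: "cnj (?E t) = of_real (r\<^sup>2) / ?E t" for t
    using complex_norm_square[of "?E t"] E0[of t] nE[of t] by (simp add: field_simps)
  have "((\<lambda>u. F u / (u - 0) ^ Suc j) has_contour_integral
          ((2 * pi * \<i>) / fact j * (deriv ^^ j) F 0)) ?E"
  proof (rule Cauchy_has_contour_integral_higher_derivative_circlepath)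
    show "continuous_on (cball 0 r) F"
      by (rule holomorphic_on_imp_continuous_on, rule holomorphic_on_subset[OF F]) (use r in auto)
    show "F holomorphic_on ball 0 r"
      by (rule holomorphic_on_subset[OF F]) (use r in auto)
  qed (use r in auto)
  then have "((\<lambda>t. F (?E t) / ?E t ^ Suc j * (2 * pi * \<i> * ?E t)) has_integral
          ((2 * pi * \<i>) / fact j * (deriv ^^ j) F 0)) {0..1}"
    by (simp add: has_contour_integral vector_derivative_circlepath E mult_ac)
  from has_integral_mult_right[OF this, of "of_real (r ^ (2 * j)) / (2 * pi * \<i>)"]
  show ?thesis
  proof (rule has_integral_eq_rhs[OF has_integral_eq, rotated])
    fix t :: real
    show "of_real (r ^ (2 * j)) / (2 * pi * \<i>) * (F (?E t) / ?E t ^ Suc j * (2 * pi * \<i> * ?E t))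
            = F (?E t) * cnj (?E t) ^ j"
      using E0[of t] by (simp add: cE power_divide field_simps flip: power_mult)
  qed (simp add: taylor_coeff_def field_simps)
qed

lemma taylor_coeff_power: "taylor_coeff (\<lambda>z. z ^ i) j = (if i = j then 1 else 0)"
proof -
  have "(deriv ^^ j) (\<lambda>z. z ^ i) 0 = pochhammer (of_nat (Suc i - j)) j * (0::complex) ^ (i - j)"
    using higher_deriv_power[of j 0 i "0::complex"] by simp
  then show ?thesis
    unfolding taylor_coeff_def
    by (cases i j rule: linorder_cases) (auto simp: pochhammer_0_left simp flip: pochhammer_fact)
qed

lemma taylor_coeff_add:
  assumes "f holomorphic_on ball 0 1" "g holomorphic_on ball 0 1"
  shows "taylor_coeff (\<lambda>z. f z + g z) k = taylor_coeff f k + taylor_coeff g k"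
  using higher_deriv_add[OF assms, of 0 k] by (simp add: taylor_coeff_def add_divide_distrib)

lemma taylor_coeff_cmult:
  assumes "f holomorphic_on ball 0 1"
  shows "taylor_coeff (\<lambda>z. c * f z) k = c * taylor_coeff f k"
  using higher_deriv_cmult[OF assms, of 0 k] by (simp add: taylor_coeff_def)

lemma taylor_coeff_polynomial:
  "taylor_coeff (\<lambda>z. \<Sum>j<L. c j * z ^ j) k = (if k < L then c k else 0)"
proof (induction L)
  case 0
  show ?case by (simp add: taylor_coeff_def)
next
  case (Suc L)
  have "taylor_coeff (\<lambda>z. (\<Sum>j<L. c j * z ^ j) + c L * z ^ L) k =
        taylor_coeff (\<lambda>z. \<Sum>j<L. c j * z ^ j) k + c L * taylor_coeff (\<lambda>z. z ^ L) k"
    by (subst taylor_coeff_add) (auto intro!: holomorphic_intros taylor_coeff_cmult)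
  then show ?case
    by (auto simp: Suc taylor_coeff_power less_Suc_eq)
qed

section \<open>Harmonic majorants and the Hardy norm\<close>

text \<open>Testing \<open>F\<close> against its own Taylor polynomial \<open>p\<close> avoids
  Parseval for an infinite series. The means of \<open>Re (F * cnj p)\<close> and of
  \<open>|p|^2\<close> are the same number \<open>S\<close>, so averaging
  \<open>0 <= |F - p|^2\<close> with \<open>|F|^2 <= Re h\<close> gives
  \<open>2 * S <= Re (h 0) + S\<close>.\<close>

lemma coeff_sum_le_harmonic_majorant:
  assumes F: "F holomorphic_on ball 0 1" and h: "h holomorphic_on ball 0 1"
    and le: "\<And>z. z \<in> ball 0 1 \<Longrightarrow> (cmod (F z))\<^sup>2 \<le> Re (h z)" and r: "0 < r" "r < 1"
  shows "(\<Sum>j<L. (cmod (taylor_coeff F j))\<^sup>2 * r ^ (2 * j)) \<le> Re (h 0)"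
proof -
  let ?E = "circlepath 0 r" and ?c = "taylor_coeff F"
  define p where "p z = (\<Sum>j<L. ?c j * z ^ j)" for z
  define S where "S = (\<Sum>j<L. (cmod (?c j))\<^sup>2 * r ^ (2 * j))"
  have E: "?E t \<in> ball 0 1" for t
    using r by (simp add: circlepath norm_mult norm_exp_eq_Re)
  \<comment> \<open>Applied below to \<open>F\<close> and to \<open>p\<close> itself; they share the
    first \<open>L\<close> coefficients, hence the common value \<open>S\<close>.\<close>
  have mean: "((\<lambda>t. Re (G (?E t) * cnj (p (?E t)))) has_integral S) {0..1}"
    if G: "G holomorphic_on ball 0 1" and cG: "\<And>j. j < L \<Longrightarrow> taylor_coeff G j = ?c j" for G
  proof -
    have "((\<lambda>t. \<Sum>j<L. cnj (?c j) * (G (?E t) * cnj (?E t) ^ j)) has_integral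
           (\<Sum>j<L. cnj (?c j) * (taylor_coeff G j * of_real (r ^ (2 * j))))) {0..1}"
      by (intro has_integral_sum has_integral_mult_right circle_mean_coeff G r) auto
    also have "(\<Sum>j<L. cnj (?c j) * (taylor_coeff G j * of_real (r ^ (2 * j)))) = of_real S"
      unfolding S_def of_real_sum
      by (intro sum.cong) (auto simp: cG mult_ac complex_norm_square of_real_mult simp flip: of_real_power)
    also have "(\<lambda>t. \<Sum>j<L. cnj (?c j) * (G (?E t) * cnj (?E t) ^ j)) = (\<lambda>t. G (?E t) * cnj (p (?E t)))"
      by (simp add: p_def sum_distrib_left mult_ac)
    finally show ?thesis
      using has_integral_linear[OF _ bounded_linear_Re] by (force simp: o_def)
  qed
  have hol_p: "p holomorphic_on ball 0 1"
    unfolding p_def by (intro holomorphic_intros)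
  have coeff_p: "taylor_coeff p j = ?c j" if "j < L" for j
    using that by (simp add: p_def[abs_def] taylor_coeff_polynomial)
  have "((\<lambda>t. Re (h (?E t))) has_integral Re (h 0)) {0..1}"
    using has_integral_linear[OF circle_mean_coeff[OF h r, of 0] bounded_linear_Re]
    by (simp add: o_def taylor_coeff_def)
  moreover have "2 * Re (F z * cnj (p z)) \<le> Re (h z) + Re (p z * cnj (p z))" if "z \<in> ball 0 1" for z
  proof -
    have "0 \<le> (cmod (F z - p z))\<^sup>2" by simp
    also have "\<dots> = (cmod (F z))\<^sup>2 - 2 * Re (F z * cnj (p z)) + Re (p z * cnj (p z))"
      unfolding cmod_power2 by (simp add: power2_eq_square algebra_simps)
    finally show ?thesis using le[OF that] by simp
  qed
  ultimately have "2 * S \<le> Re (h 0) + S"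
    using has_integral_le[OF has_integral_mult_right[OF mean[OF F refl], of 2]
        has_integral_add[OF _ mean[OF hol_p coeff_p]]] E by simp
  then show ?thesis by (simp add: S_def)
qed

text \<open>For fixed \<open>L\<close>, let \<open>r\<close> tend to 1 in the preceding bound; the
  partial sums are then bounded uniformly in \<open>L\<close>.\<close>

lemma H2_harmonic_majorant:
  assumes F: "F holomorphic_on ball 0 1" and h: "h holomorphic_on ball 0 1"
    and le: "\<And>z. z \<in> ball 0 1 \<Longrightarrow> (cmod (F z))\<^sup>2 \<le> Re (h z)"
  shows "F \<in> H2" and "h2norm F \<le> sqrt (Re (h 0))"
proof -
  let ?a = "\<lambda>j. (cmod (taylor_coeff F j))\<^sup>2"
  have bound: "(\<Sum>j<L. ?a j) \<le> Re (h 0)" for L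
  proof (rule tendsto_le)
    show "((\<lambda>r. \<Sum>j<L. ?a j * r ^ (2 * j)) \<longlongrightarrow> (\<Sum>j<L. ?a j)) (at_left (1::real))"
      by (rule tendsto_eq_intros refl | simp)+
    show "\<forall>\<^sub>F r in at_left 1. (\<Sum>j<L. ?a j * r ^ (2 * j)) \<le> Re (h 0)"
      using eventually_at_left_real[OF zero_less_one]
      by eventually_elim (auto intro: coeff_sum_le_harmonic_majorant[OF F h le])
  qed auto
  have "summable ?a"
    by (rule bounded_imp_summable[of _ "Re (h 0)"]) (auto intro: bound simp del: sum.lessThan_Suc simp flip: lessThan_Suc_atMost)
  then show "F \<in> H2" "h2norm F \<le> sqrt (Re (h 0))"
    using F suminf_le_const[OF _ bound] by (auto simp: H2_def h2norm_def)
qed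

section \<open>Truncated Taylor series and approximation numbers\<close>

lemma cauchy_schwarz_suminf:
  fixes a b :: "nat \<Rightarrow> complex"
  assumes a: "summable (\<lambda>k. (cmod (a k))\<^sup>2)" and b: "summable (\<lambda>k. (cmod (b k))\<^sup>2)"
    and s: "(\<lambda>k. a k * b k) sums s"
  shows "(cmod s)\<^sup>2 \<le> (\<Sum>k. (cmod (a k))\<^sup>2) * (\<Sum>k. (cmod (b k))\<^sup>2)"
proof (rule LIMSEQ_le_const2)
  show "(\<lambda>n. (cmod (\<Sum>k<n. a k * b k))\<^sup>2) \<longlonglongrightarrow> (cmod s)\<^sup>2"
    using s unfolding sums_def by (intro tendsto_intros)
  have "(cmod (\<Sum>k<n. a k * b k))\<^sup>2 \<le> (\<Sum>k. (cmod (a k))\<^sup>2) * (\<Sum>k. (cmod (b k))\<^sup>2)" for n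
  proof -
    have "cmod (\<Sum>k<n. a k * b k) \<le> (\<Sum>k<n. cmod (a k) * cmod (b k))"
      by (rule order_trans[OF norm_sum]) (simp add: norm_mult)
    then have "(cmod (\<Sum>k<n. a k * b k))\<^sup>2 \<le> (\<Sum>k<n. cmod (a k) * cmod (b k))\<^sup>2"
      by (rule power_mono) simp
    also have "\<dots> \<le> (\<Sum>k<n. (cmod (a k))\<^sup>2) * (\<Sum>k<n. (cmod (b k))\<^sup>2)"
      by (rule Cauchy_Schwarz_ineq_sum)
    also have "\<dots> \<le> (\<Sum>k. (cmod (a k))\<^sup>2) * (\<Sum>k. (cmod (b k))\<^sup>2)"
      by (intro mult_mono sum_le_suminf a b suminf_nonneg sum_nonneg) auto
    finally show ?thesis .
  qed
  then show "\<exists>N. \<forall>n\<ge>N. (cmod (\<Sum>k<n. a k * b k))\<^sup>2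
      \<le> (\<Sum>k. (cmod (a k))\<^sup>2) * (\<Sum>k. (cmod (b k))\<^sup>2)" by blast
qed

lemma bounded_imp_H2:
  assumes "F holomorphic_on ball 0 1" "\<And>z. z \<in> ball 0 1 \<Longrightarrow> cmod (F z) \<le> 1"
  shows "F \<in> H2"
  by (rule H2_harmonic_majorant(1)[of F "\<lambda>_. 1"]) (use assms in \<open>auto simp: power_le_one\<close>)

text \<open>The quotient on the right is the geometric series of \<open>|w|^(2k)\<close> over
  \<open>k >= N\<close>, the second factor in Cauchy-Schwarz.\<close>

lemma taylor_remainder_le:
  assumes f: "f \<in> H2" and w: "w \<in> ball 0 1"
  shows "(cmod (f w - (\<Sum>i<N. taylor_coeff f i * w ^ i)))\<^sup>2
           \<le> (h2norm f)\<^sup>2 * ((cmod w) ^ (2 * N) / (1 - (cmod w)\<^sup>2))"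
proof -
  let ?a = "\<lambda>k. taylor_coeff f (k + N)" and ?b = "\<lambda>k. w ^ (k + N)"
  have hol: "f holomorphic_on ball 0 1" and sum: "summable (\<lambda>k. (cmod (taylor_coeff f k))\<^sup>2)"
    using f by (auto simp: H2_def)
  have w1: "(cmod w)\<^sup>2 < 1"
    using w by (simp add: abs_square_less_1)
  have "(\<lambda>k. taylor_coeff f k * w ^ k) sums f w"
    using holomorphic_power_series[OF hol w] by (simp add: taylor_coeff_def)
  from sums_split_initial_segment[OF this, of N]
  have ab: "(\<lambda>k. ?a k * ?b k) sums (f w - (\<Sum>i<N. taylor_coeff f i * w ^ i))" .
  have geo: "(\<lambda>k. (cmod (?b k))\<^sup>2) sums ((cmod w) ^ (2 * N) / (1 - (cmod w)\<^sup>2))"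
    using sums_mult[OF geometric_sums[of "(cmod w)\<^sup>2"], of "(cmod w) ^ (2 * N)"] w1
    by (simp add: norm_power norm_mult power_add power_mult_distrib mult_ac flip: power_mult)
  have sa: "summable (\<lambda>k. (cmod (?a k))\<^sup>2)"
    using sum by (subst summable_iff_shift)
  have "(cmod (f w - (\<Sum>i<N. taylor_coeff f i * w ^ i)))\<^sup>2
      \<le> (\<Sum>k. (cmod (?a k))\<^sup>2) * ((cmod w) ^ (2 * N) / (1 - (cmod w)\<^sup>2))"
    using cauchy_schwarz_suminf[OF sa sums_summable[OF geo] ab] by (simp only: sums_unique[OF geo])
  also have "\<dots> \<le> (h2norm f)\<^sup>2 * ((cmod w) ^ (2 * N) / (1 - (cmod w)\<^sup>2))"
  proof (rule mult_right_mono)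
    have "(\<Sum>k. (cmod (?a k))\<^sup>2) \<le> (\<Sum>k. (cmod (taylor_coeff f k))\<^sup>2)"
      using suminf_split_initial_segment[OF sum, of N] by (simp add: sum_nonneg)
    also have "\<dots> = (h2norm f)\<^sup>2"
      using sum by (simp add: h2norm_def suminf_nonneg)
    finally show "(\<Sum>k. (cmod (?a k))\<^sup>2) \<le> (h2norm f)\<^sup>2" .
  qed (use w1 in auto)
  finally show ?thesis .
qed

text \<open>The competitor \<open>R\<close> composes a Taylor polynomial of \<open>f\<close> with
  \<open>\<phi>\<close>, so its range lies in the span of the first \<open>n - 1\<close> powers of
  \<open>\<phi>\<close>. The squared error is at most \<open>(h2norm f * M)^2 * Re h\<close>, a
  harmonic majorant whose value at 0 controls the norm.\<close>

lemma approx_num_comp_op_bounds: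
  assumes \<phi>: "\<phi> holomorphic_on ball 0 1" "\<phi> ` ball 0 1 \<subseteq> ball 0 1"
    and h: "h holomorphic_on ball 0 1" and M: "M \<ge> 0"
    and le: "\<And>z. z \<in> ball 0 1 \<Longrightarrow>
      cmod (\<phi> z) ^ (2 * (n - 1)) / (1 - (cmod (\<phi> z))\<^sup>2) \<le> M\<^sup>2 * Re (h z)"
  shows "0 \<le> approx_num (comp_op \<phi>) n" "approx_num (comp_op \<phi>) n \<le> M * sqrt (Re (h 0))"
proof -
  let ?N = "n - 1"
  define R where "R f = (\<lambda>z. \<Sum>i<?N. taylor_coeff f i * \<phi> z ^ i)" for f
  have \<phi>1: "cmod (\<phi> z) < 1" if "z \<in> ball 0 1" for z
    using \<phi>(2) that by (metis image_subset_iff mem_ball_0)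
  \<comment> \<open>\<open>sqrt\<close> is negative at negative reals, so the sign of
    \<open>Re (h 0)\<close> has to be settled. It follows from \<open>le\<close> when
    \<open>M > 0\<close>; for \<open>M = 0\<close> the product is 0 anyway.\<close>
  have h0: "Re (h z) \<ge> 0" if "z \<in> ball 0 1" "M > 0" for z
  proof -
    have "0 \<le> cmod (\<phi> z) ^ (2 * ?N) / (1 - (cmod (\<phi> z))\<^sup>2)"
      using \<phi>1[OF that(1)] by (simp add: power_le_one)
    then show ?thesis using le[OF that(1)] that(2)
      by (smt (verit) zero_le_mult_iff zero_less_power)
  qed
  have rank: "rank_le_op R ?N"
    unfolding rank_le_op_def
  proof (intro conjI ballI allI)
    fix f g assume "f \<in> H2" "g \<in> H2"
    then show "R (\<lambda>z. f z + g z) = (\<lambda>z. R f z + R g z)"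
      by (simp add: R_def H2_def taylor_coeff_add distrib_right sum.distrib)
  next
    fix f c assume "f \<in> H2"
    then show "R (\<lambda>z. c * f z) = (\<lambda>z. c * R f z)"
      by (simp add: R_def H2_def taylor_coeff_cmult sum_distrib_left mult_ac)
  next
    show "\<exists>g. (\<forall>i<?N. g i \<in> H2) \<and> (\<forall>f\<in>H2. \<exists>c. R f = (\<lambda>z. \<Sum>i<?N. c i * g i z))"
    proof (intro exI[of _ "\<lambda>i z. \<phi> z ^ i"] conjI allI impI ballI)
      fix i
      show "(\<lambda>z. \<phi> z ^ i) \<in> H2"
        by (rule bounded_imp_H2)
          (auto intro!: holomorphic_intros \<phi> power_le_one less_imp_le[OF \<phi>1] simp: norm_power)
    next
      fix f
      show "\<exists>c. R f = (\<lambda>z. \<Sum>i<?N. c i * \<phi> z ^ i)"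
        by (auto simp: R_def)
    qed
  qed
  have "h2norm (\<lambda>z. comp_op \<phi> f z - R f z) \<le> M * sqrt (Re (h 0)) * h2norm f" if f: "f \<in> H2" for f
  proof -
    have nn: "h2norm f \<ge> 0"
      using f by (simp add: h2norm_def H2_def suminf_nonneg)
    have holf: "f holomorphic_on ball 0 1"
      using f by (simp add: H2_def)
    have "h2norm (\<lambda>z. comp_op \<phi> f z - R f z) \<le> sqrt (Re (of_real ((h2norm f * M)\<^sup>2) * h 0))"
    proof (rule H2_harmonic_majorant(2))
      have "f \<circ> \<phi> holomorphic_on ball 0 1"
        by (rule holomorphic_on_compose_gen[OF \<phi>(1) holf \<phi>(2)])
      then show "(\<lambda>z. comp_op \<phi> f z - R f z) holomorphic_on ball 0 1"
        unfolding R_def comp_op_def by (intro holomorphic_on_diff holomorphic_intros \<phi>)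
      show "(\<lambda>z. of_real ((h2norm f * M)\<^sup>2) * h z) holomorphic_on ball 0 1"
        by (intro holomorphic_intros h)
      fix z :: complex assume z: "z \<in> ball 0 1"
      have "(cmod (comp_op \<phi> f z - R f z))\<^sup>2
          \<le> (h2norm f)\<^sup>2 * (cmod (\<phi> z) ^ (2 * ?N) / (1 - (cmod (\<phi> z))\<^sup>2))"
        using taylor_remainder_le[OF f, of "\<phi> z" ?N] \<phi>1[OF z] by (simp add: comp_op_def R_def)
      also have "\<dots> \<le> (h2norm f)\<^sup>2 * (M\<^sup>2 * Re (h z))"
        by (intro mult_left_mono le z) auto
      finally show "(cmod (comp_op \<phi> f z - R f z))\<^sup>2 \<le> Re (of_real ((h2norm f * M)\<^sup>2) * h z)"
        by (simp add: power_mult_distrib mult_ac flip: of_real_power of_real_mult)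
    qed
    also have "Re (of_real ((h2norm f * M)\<^sup>2) * h 0) = (h2norm f * M)\<^sup>2 * Re (h 0)"
      by (simp flip: of_real_power of_real_mult)
    also have "sqrt \<dots> = M * sqrt (Re (h 0)) * h2norm f"
      using nn M by (simp add: real_sqrt_mult)
    finally show ?thesis .
  qed
  moreover have "0 \<le> M * sqrt (Re (h 0))"
    using M h0[of 0] by (cases "M = 0") auto
  \<comment> \<open>An infimum of reals is informative only for a nonempty set bounded below. This
    membership gives nonemptiness for the lower estimate and the competitor for the upper
    one.\<close>
  ultimately have mem: "M * sqrt (Re (h 0)) \<in> {M. M \<ge> 0 \<and> (\<exists>R. rank_le_op R ?N \<and>
      (\<forall>f\<in>H2. h2norm (\<lambda>z. comp_op \<phi> f z - R f z) \<le> M * h2norm f))}"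
    using rank by auto
  then show "0 \<le> approx_num (comp_op \<phi>) n"
    unfolding approx_num_def by (intro cInf_greatest) auto
  show "approx_num (comp_op \<phi>) n \<le> M * sqrt (Re (h 0))"
    unfolding approx_num_def using mem by (intro cInf_lower bdd_belowI[of _ 0]) auto
qed

section \<open>The boundary profile\<close>

text \<open>\<open>\<beta> N\<close> is the decay exponent wanted after truncation at
  \<open>N\<close>. The loss \<open>y / 4\<close> is affordable because the harmonic majorant will
  grow like \<open>exp y\<close>. The summand \<open>exp (- y / 4) / 2\<close> of \<open>g\<close>
  makes it strictly decreasing, unbounded towards minus infinity and never too small.\<close>

lemma exists_slow_profile:
  fixes \<beta> :: "nat \<Rightarrow> real"
  assumes \<beta>: "(\<lambda>N. \<beta> N / real N) \<longlonglongrightarrow> 0"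
  obtains g :: "real \<Rightarrow> real" and C where
    "continuous_on UNIV g" "\<And>y y'. y < y' \<Longrightarrow> g y' < g y" "\<And>x. x > 0 \<Longrightarrow> \<exists>y. g y = x"
    "g 0 \<le> 1" "\<And>y. g y \<ge> exp (- y / 4) / 2" "\<And>N y. y \<ge> 0 \<Longrightarrow> \<beta> N - C - y / 4 \<le> real N * g y"
proof -
  obtain N0 where N0: "\<And>N. N \<ge> N0 \<Longrightarrow> \<bar>\<beta> N / real N\<bar> < 1 / 2"
    using LIMSEQ_D[OF \<beta>, of "1/2"] by auto
  \<comment> \<open>\<open>C\<close> dominates the finitely many \<open>\<beta> N\<close> with
    \<open>N \<le> N0\<close>, where the ratio need not be below 1/2.\<close>
  define C where "C = (\<Sum>N\<le>N0. \<bar>\<beta> N\<bar>)"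
  have C: "\<beta> N - C \<le> real N / 2" for N
  proof (cases "N \<le> N0")
    case True
    then have "\<bar>\<beta> N\<bar> \<le> C"
      unfolding C_def by (intro member_le_sum) auto
    then show ?thesis by simp
  next
    case False
    then have "\<beta> N / real N \<le> 1 / 2" using N0[of N] by simp
    then have "\<beta> N \<le> real N / 2" using False by (simp add: field_simps)
    moreover have "C \<ge> 0" by (auto simp: C_def intro: sum_nonneg)
    ultimately show ?thesis by simp
  qed
  \<comment> \<open>The supremum \<open>\<gamma>\<close> is the smallest nonnegative function with the required lower bound;
    subtracting \<open>C\<close> makes it at most 1/2 at 0. At \<open>N = 0\<close> the quotient is 0.\<close>
  define q where "q y N = max 0 ((\<beta> N - C - y / 4) / real N)" for y N
  define \<gamma> where "\<gamma> y = (SUP N. q y N)" for y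
  \<comment> \<open>The slope in \<open>y\<close> is at most 1/4 for every \<open>N\<close>; such a
    uniform Lipschitz constant survives the supremum and makes \<open>\<gamma>\<close>
    continuous.\<close>
  have lip: "q y N \<le> q y' N + \<bar>y - y'\<bar> / 4" for y y' N
  proof (cases "N = 0")
    case False
    have "(\<beta> N - C - y / 4) / real N = (\<beta> N - C - y' / 4) / real N + (y' - y) / 4 / real N"
      by (simp add: diff_divide_distrib)
    also have "(y' - y) / 4 / real N \<le> \<bar>y - y'\<bar> / 4"
    proof -
      have "(y' - y) / 4 / real N \<le> \<bar>y - y'\<bar> / 4 / real N"
        by (intro divide_right_mono) auto
      also have "\<dots> \<le> \<bar>y - y'\<bar> / 4 / 1"
        using False by (intro divide_left_mono) auto
      finally show ?thesis by simp
    qed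
    finally have "(\<beta> N - C - y / 4) / real N \<le> max 0 ((\<beta> N - C - y' / 4) / real N) + \<bar>y - y'\<bar> / 4"
      by linarith
    then show ?thesis unfolding q_def by (intro max.boundedI) auto
  qed (simp add: q_def)
  have q0: "q 0 N \<le> 1 / 2" for N
    using C[of N] unfolding q_def by (intro max.boundedI; cases "N = 0") (auto simp: field_simps)
  have qb: "q y N \<le> 1 / 2 + \<bar>y\<bar> / 4" for y N
    using lip[of y N 0] q0[of N] by simp
  have bdd: "bdd_above (range (q y))" for y
    using qb by (auto intro!: bdd_aboveI[of _ "1/2 + \<bar>y\<bar>/4"])
  have q_le: "q y N \<le> \<gamma> y" for y N
    unfolding \<gamma>_def by (intro cSUP_upper bdd) auto
  have \<gamma>_le: "\<gamma> y \<le> B" if "\<And>N. q y N \<le> B" for y B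
    unfolding \<gamma>_def by (intro cSUP_least that) auto
  have \<gamma>_lip: "\<gamma> y \<le> \<gamma> y' + \<bar>y - y'\<bar> / 4" for y y'
    by (intro \<gamma>_le order_trans[OF lip[of y _ y']]) (simp add: q_le)
  have \<gamma>_mono: "\<gamma> y' \<le> \<gamma> y" if "y \<le> y'" for y y'
  proof (rule \<gamma>_le)
    fix N
    have "q y' N \<le> q y N"
      unfolding q_def by (intro max.mono divide_right_mono) (use that in auto)
    then show "q y' N \<le> \<gamma> y" using q_le[of y N] by linarith
  qed
  have \<gamma>_pos: "\<gamma> y \<ge> 0" for y
    using q_le[of y 0] by (simp add: q_def)
  \<comment> \<open>For \<open>N\<close> beyond \<open>N1\<close> the ratio is already below
    \<open>d\<close>; the finitely many remaining numerators become nonpositive once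
    \<open>Y / 4\<close> exceeds their \<open>\<bar>\<beta> N\<bar>\<close>.\<close>
  have \<gamma>_lim: "\<exists>y. \<gamma> y \<le> d" if "d > 0" for d
  proof -
    obtain N1 where N1: "\<And>N. N \<ge> N1 \<Longrightarrow> \<bar>\<beta> N / real N\<bar> < d"
      using LIMSEQ_D[OF \<beta>, of d] \<open>d > 0\<close> by auto
    define Y where "Y = 4 * (\<Sum>N\<le>N1. \<bar>\<beta> N\<bar>)"
    have C0: "C \<ge> 0" by (auto simp: C_def intro: sum_nonneg)
    have Y0: "Y \<ge> 0" by (auto simp: Y_def intro: sum_nonneg)
    have "q Y N \<le> d" for N
    proof (cases "N \<le> N1")
      case True
      then have "\<bar>\<beta> N\<bar> \<le> Y / 4"
        unfolding Y_def by (simp, intro member_le_sum) auto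
      then have "\<beta> N - C - Y / 4 \<le> 0" using C0 by simp
      then have "(\<beta> N - C - Y / 4) / real N \<le> 0" by (intro divide_nonpos_nonneg) auto
      then show ?thesis using that by (simp add: q_def)
    next
      case False
      have "(\<beta> N - C - Y / 4) / real N \<le> \<beta> N / real N"
        using C0 Y0 by (intro divide_right_mono) auto
      moreover have "\<beta> N / real N \<le> d"
        using N1[of N] False by linarith
      ultimately show ?thesis using that by (simp add: q_def)
    qed
    then show ?thesis using \<gamma>_le by blast
  qed
  define g where "g y = exp (- y / 4) / 2 + \<gamma> y" for y
  have cont: "continuous_on UNIV g"
  proof -
    have "(1/4)-lipschitz_on UNIV \<gamma>"
    proof (rule lipschitz_onI)
      fix y y' :: real
      show "dist (\<gamma> y) (\<gamma> y') \<le> 1 / 4 * dist y y'"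
        using \<gamma>_lip[of y y'] \<gamma>_lip[of y' y] unfolding dist_real_def abs_minus_commute[of y' y] abs_le_iff by simp
    qed simp
    then show ?thesis
      unfolding g_def by (intro continuous_intros lipschitz_on_continuous_on) auto
  qed
  have surj: "\<exists>y. g y = x" if x: "x > 0" for x
  proof -
    obtain y0 where y0: "\<gamma> y0 \<le> x / 2" using \<gamma>_lim[of "x/2"] x by auto
    \<comment> \<open>Endpoints for the intermediate value theorem: at \<open>b\<close> both
      summands of \<open>g\<close> are at most \<open>x / 2\<close>, at \<open>a\<close> the
      exponential summand alone equals \<open>x\<close>.\<close>
    define b where "b = max y0 (- 4 * ln x)"
    define a where "a = - 4 * ln (2 * x)"
    have "exp (- b / 4) \<le> exp (ln x)" by (simp add: b_def)
    then have gb: "g b \<le> x"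
      using x y0 \<gamma>_mono[of y0 b] by (simp add: g_def b_def)
    have ga: "g a \<ge> x"
      using x \<gamma>_pos[of a] by (simp add: g_def a_def)
    have "a \<le> b"
      using x ln_le_cancel_iff[of x "2 * x"] unfolding a_def b_def by linarith
    then show ?thesis
      using IVT2'[of g b x a, OF gb ga] continuous_on_subset[OF cont, of "{a..b}"] by blast
  qed
  show thesis
  proof (rule that[of g C])
    show "continuous_on UNIV g" by (rule cont)
    show "g y' < g y" if "y < y'" for y y'
      using that \<gamma>_mono[of y y'] by (simp add: g_def add_less_le_mono)
    show "g 0 \<le> 1"
      using \<gamma>_le[OF q0] by (simp add: g_def)
    show "g y \<ge> exp (- y / 4) / 2" for y
      using \<gamma>_pos[of y] by (simp add: g_def)
    show "\<beta> N - C - y / 4 \<le> real N * g y" if "y \<ge> 0" for N y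
    proof (cases "N = 0")
      case True
      then show ?thesis using C[of 0] that by simp
    next
      case False
      have "(\<beta> N - C - y / 4) / real N \<le> g y"
        using q_le[of y N] by (simp add: q_def g_def add_increasing)
      then show ?thesis using False by (simp add: field_simps)
    qed
  qed (rule surj)
qed

section \<open>The Blaschke product\<close>

text \<open>The zero at 1/2 recovers the value 0, which \<open>exp (- f)\<close> omits as a map into
  the punctured disk; the zero at 0 keeps the modulus from increasing.\<close>

definition blaschke :: "complex \<Rightarrow> complex" where
  "blaschke z = z * ((z - 1 / 2) / (1 - z / 2))"

lemma blaschke_denom_nonzero: "cmod z < 1 \<Longrightarrow> 1 - z / 2 \<noteq> 0"
proof
  assume "cmod z < 1" "1 - z / 2 = 0"
  then have "z = 2" by (simp add: field_simps)
  with \<open>cmod z < 1\<close> show False by simp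
qed

lemma norm_blaschke_le:
  assumes "cmod z < 1"
  shows "cmod (blaschke z) \<le> cmod z"
proof -
  have "(cmod (1 - z / 2))\<^sup>2 - (cmod (z - 1 / 2))\<^sup>2 = 3 / 4 * (1 - (cmod z)\<^sup>2)"
    unfolding cmod_power2 by (simp add: power2_eq_square field_simps)
  also have "\<dots> \<ge> 0"
    using assms by (simp add: power_le_one)
  finally have "(cmod (z - 1 / 2))\<^sup>2 \<le> (cmod (1 - z / 2))\<^sup>2"
    by linarith
  then have "cmod (z - 1 / 2) \<le> cmod (1 - z / 2)"
    by (rule power2_le_imp_le) (rule norm_ge_zero)
  then have "cmod (z - 1 / 2) / cmod (1 - z / 2) \<le> 1"
    by (rule divide_le_eq_1_pos[THEN iffD2, rotated])
      (use blaschke_denom_nonzero[OF assms] in \<open>simp only: zero_less_norm_iff not_False_eq_True\<close>)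
  then show ?thesis
    unfolding blaschke_def norm_mult norm_divide by (rule mult_left_le) (rule norm_ge_zero)
qed

text \<open>Clearing the denominator gives a monic quadratic in \<open>z\<close> with constant term
  \<open>- w\<close>. The product of its roots is recorded in order to locate one of them in the
  disk.\<close>

lemma blaschke_roots:
  obtains s t where "s * t = - w" "\<And>z. cmod z < 1 \<Longrightarrow> blaschke z = w \<longleftrightarrow> z = s \<or> z = t"
proof -
  define b where "b = (1 - w) / 4"
  define d where "d = csqrt (b\<^sup>2 + w)"
  have d: "d * d = b * b + w"
    by (simp add: d_def flip: power2_eq_square)
  have "blaschke z = w \<longleftrightarrow> z = b + d \<or> z = b - d" if z: "cmod z < 1" for z
  proof -
    have "blaschke z = w \<longleftrightarrow> z * (z - 1 / 2) = w * (1 - z / 2)"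
      using blaschke_denom_nonzero[OF z] by (simp add: blaschke_def nonzero_divide_eq_eq)
    also have "\<dots> \<longleftrightarrow> (z - (b + d)) * (z - (b - d)) = 0"
    proof -
      have "(z - (b + d)) * (z - (b - d)) = z * z - 2 * b * z + b * b - d * d"
        by (simp add: algebra_simps)
      also have "\<dots> = z * (z - 1 / 2) - w * (1 - z / 2)"
        unfolding d by (simp add: b_def field_simps)
      finally show ?thesis by simp
    qed
    finally show ?thesis by auto
  qed
  moreover have "(b + d) * (b - d) = - w"
    using d by (simp add: algebra_simps)
  ultimately show thesis using that by blast
qed

text \<open>The two roots have product of modulus below 1, so one lies in the disk. A nonzero
  preimage is needed because \<open>exp\<close> never vanishes.\<close>

lemma blaschke_preimage:
  assumes "cmod w < 1"
  obtains z where "cmod z < 1" "z \<noteq> 0" "blaschke z = w"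
proof (cases "w = 0")
  case True
  show thesis by (rule that[of "1/2"]) (auto simp: True blaschke_def norm_divide)
next
  case False
  obtain s t where st: "s * t = - w" "\<And>z. cmod z < 1 \<Longrightarrow> blaschke z = w \<longleftrightarrow> z = s \<or> z = t"
    using blaschke_roots[of w] by blast
  have "cmod s * cmod t < 1"
    using st(1) assms by (metis norm_minus_cancel norm_mult)
  then have "cmod s < 1 \<or> cmod t < 1"
    using mult_mono[of 1 "cmod s" 1 "cmod t"] by force
  moreover have "s \<noteq> 0" "t \<noteq> 0"
    using st(1) False by auto
  ultimately show thesis using st(2) that by blast
qed

section \<open>Counting preimages\<close>

lemma card_le_2_of_subset: "A \<subseteq> {a, b} \<Longrightarrow> finite A \<and> card A \<le> 2"
  using card_mono[of "{a, b}" A] card_insert_le_m1[of 2 "{b}" a] finite_subset[of A "{a, b}"]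
  by (auto intro: order_trans)

lemma card_fibre_compose_le:
  assumes p: "\<And>w. finite {v \<in> B. p v = w} \<and> card {v \<in> B. p v = w} \<le> m"
    and q: "\<And>v. finite {z \<in> A. q z = v} \<and> card {z \<in> A. q z = v} \<le> k"
    and sub: "q ` A \<subseteq> B"
  shows "finite {z \<in> A. p (q z) = w} \<and> card {z \<in> A. p (q z) = w} \<le> m * k"
proof -
  let ?S = "{v \<in> B. p v = w}"
  have eq: "{z \<in> A. p (q z) = w} = (\<Union>v\<in>?S. {z \<in> A. q z = v})"
    using sub by auto
  have "card (\<Union>v\<in>?S. {z \<in> A. q z = v}) \<le> (\<Sum>v\<in>?S. card {z \<in> A. q z = v})"
    using p by (intro card_UN_le) auto
  also have "\<dots> \<le> (\<Sum>v\<in>?S. k)"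
    using q by (intro sum_mono) auto
  also have "\<dots> \<le> m * k"
    using p[of w] by simp
  finally show ?thesis
    unfolding eq using p q by auto
qed

section \<open>The spiral domain and its Riemann map\<close>

text \<open>\<open>exp (- w)\<close> winds this strip around the origin, from near 0 out towards the
  unit circle. An open vertical interval of length \<open>2 * pi\<close> would omit one argument for
  each modulus; length \<open>4 * pi\<close> meets every argument once or twice.\<close>

definition spiral_domain :: "(real \<Rightarrow> real) \<Rightarrow> complex set" where
  "spiral_domain g = {w. g (Im w) < Re w \<and> Re w < g (Im w - 4 * pi)}"

text \<open>The modulus of \<open>v\<close> fixes \<open>Re w = g Y\<close>, leaving the interval
  from \<open>Y\<close> to \<open>Y + 4 * pi\<close> for \<open>Im w\<close>; the argument of
  \<open>v\<close> fixes \<open>Im w\<close> modulo \<open>2 * pi\<close>.\<close>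

lemma spiral_domain_exp_fibre:
  assumes mono: "\<And>y y'. y < y' \<Longrightarrow> g y' < g y" and surj: "\<And>x. x > 0 \<Longrightarrow> \<exists>y. g y = x"
    and v: "v \<noteq> 0" "cmod v < 1"
  obtains u where "u \<in> spiral_domain g" "exp (- u) = v"
    "{w \<in> spiral_domain g. exp (- w) = v} \<subseteq> {u, u + 2 * pi * \<i>}"
proof -
  have lt: "g y' < g y \<longleftrightarrow> y < y'" for y y'
    using mono[of y y'] mono[of y' y] by (cases y y' rule: linorder_cases) auto
  obtain Y where Y: "g Y = - ln (cmod v)"
    using surj[of "- ln (cmod v)"] v by auto
  have mem: "w \<in> spiral_domain g \<longleftrightarrow> Y < Im w \<and> Im w < Y + 4 * pi" if "exp (- w) = v" for w
  proof -
    have "cmod v = exp (- Re w)"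
      using that by (auto simp: norm_exp_eq_Re)
    then have "Re w = g Y"
      using Y by simp
    then show ?thesis
      by (auto simp: spiral_domain_def lt)
  qed
  \<comment> \<open>Chosen so that \<open>Im u\<close> lies in the half-open lower half
    \<open>(Y, Y + 2 * pi]\<close>; only one further translate can then fit.\<close>
  define n where "n = \<lfloor>(Y + 2 * pi + Im (Ln v)) / (2 * pi)\<rfloor>"
  define u where "u = - Ln v + of_int (2 * n) * pi * \<i>"
  have eu: "exp (- u) = v"
  proof -
    have "exp (- u) = exp (Ln v)"
      unfolding exp_eq by (rule exI[of _ "- n"]) (simp add: u_def)
    then show ?thesis using v by simp
  qed
  have "of_int n \<le> (Y + 2 * pi + Im (Ln v)) / (2 * pi)" "(Y + 2 * pi + Im (Ln v)) / (2 * pi) < of_int n + 1"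
    unfolding n_def by linarith+
  then have Im_u: "Y < Im u" "Im u \<le> Y + 2 * pi"
    by (simp_all add: u_def field_simps)
  show thesis
  proof (rule that[of u])
    show "u \<in> spiral_domain g"
      unfolding mem[OF eu] using Im_u pi_gt_zero by linarith
    show "{w \<in> spiral_domain g. exp (- w) = v} \<subseteq> {u, u + 2 * pi * \<i>}"
    proof
      fix w assume w: "w \<in> {w \<in> spiral_domain g. exp (- w) = v}"
      then have "exp (- u) = exp (- w)" using eu by simp
      then obtain k :: int where "- u = - w + of_int (2 * k) * pi * \<i>"
        unfolding exp_eq by blast
      then have k: "w = u + of_int (2 * k) * pi * \<i>"
        by (simp add: algebra_simps)
      have "Y < Im w" "Im w < Y + 4 * pi"
        using w mem by auto
      moreover have "Im w = Im u + pi * (2 * of_int k)"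
        by (simp add: k)
      ultimately have "pi * (2 * of_int k) > pi * (- 2)" "pi * (2 * of_int k) < pi * 4"
        using Im_u by linarith+
      then have "(2 * of_int k :: real) > - 2" "(2 * of_int k :: real) < 4"
        using pi_gt_zero by (auto simp only: mult_less_cancel_left_pos)
      then have "k = 0 \<or> k = 1" by linarith
      then show "w \<in> {u, u + 2 * pi * \<i>}" by (auto simp: k)
    qed
  qed (rule eu)
qed

text \<open>Rescaling each horizontal section affinely to the unit interval gives a homeomorphism
  with a straight convex strip, hence simple connectivity. The domain is nonempty and omits 0, so it
  is a proper one for the Riemann mapping theorem.\<close>

lemma spiral_domain_riemann_map:
  assumes cont: "continuous_on UNIV g" and mono: "\<And>y y'. y < y' \<Longrightarrow> g y' < (g y :: real)"
    and pos: "\<And>y. g y > 0"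
  obtains f where "f holomorphic_on ball 0 1" "bij_betw f (ball 0 1) (spiral_domain g)"
proof -
  let ?\<Omega> = "spiral_domain g" and ?S = "{w. 0 < Re w \<and> Re w < 1}"
  define \<Phi> where "\<Phi> w = Complex (g (Im w) + Re w * (g (Im w - 4 * pi) - g (Im w))) (Im w)" for w
  define \<Psi> where "\<Psi> w = Complex ((Re w - g (Im w)) / (g (Im w - 4 * pi) - g (Im w))) (Im w)" for w
  have wd: "g (y - 4 * pi) - g y > 0" for y
    using mono[of "y - 4 * pi" y] by simp
  have cg: "continuous_on A (\<lambda>x. g (k x))" if "continuous_on A k" for A and k :: "complex \<Rightarrow> real"
    by (rule continuous_on_compose2[OF cont that]) auto
  have "?S homeomorphic ?\<Omega>"
  proof (rule homeomorphicI[of \<Phi> _ _ \<Psi>])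
    have 1: "\<Psi> (\<Phi> w) = w" "\<Phi> (\<Psi> w) = w" for w
      using wd[of "Im w"] by (simp_all add: \<Phi>_def \<Psi>_def complex_eq_iff)
    show "\<Psi> (\<Phi> w) = w" "\<Phi> (\<Psi> w) = w" for w by (fact 1)+
    have 2: "\<Phi> w \<in> ?\<Omega>" if "w \<in> ?S" for w
    proof -
      define W where "W = g (Im w - 4 * pi) - g (Im w)"
      have "Re w * W < 1 * W" "0 < Re w * W"
        using that wd[of "Im w"] by (auto simp: W_def intro!: mult_strict_right_mono)
      moreover have "Re (\<Phi> w) = g (Im w) + Re w * W" "Im (\<Phi> w) = Im w"
        by (simp_all add: \<Phi>_def W_def)
      ultimately show ?thesis
        by (simp add: spiral_domain_def W_def del: mult_less_cancel_right1)
    qed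
    have 3: "\<Psi> w \<in> ?S" if "w \<in> ?\<Omega>" for w
      using that wd[of "Im w"] by (simp add: \<Psi>_def spiral_domain_def)
    show "\<Phi> ` ?S = ?\<Omega>"
    proof
      show "?\<Omega> \<subseteq> \<Phi> ` ?S"
        by (rule subsetI, rule image_eqI[OF _ 3]) (simp_all only: 1)
    qed (use 2 in blast)
    show "\<Psi> ` ?\<Omega> = ?S"
    proof
      show "?S \<subseteq> \<Psi> ` ?\<Omega>"
        by (rule subsetI, rule image_eqI[OF _ 2]) (simp_all only: 1)
    qed (use 3 in blast)
    show "continuous_on ?S \<Phi>" "continuous_on ?\<Omega> \<Psi>"
      unfolding \<Phi>_def[abs_def] \<Psi>_def[abs_def] Complex_eq
      using wd by (auto intro!: continuous_intros cg simp: less_imp_neq[symmetric])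
  qed
  moreover have "convex ?S"
    using convex_Int[OF convex_halfspace_Re_gt[of 0] convex_halfspace_Re_lt[of 1]]
    by (simp add: Int_def)
  ultimately have "simply_connected ?\<Omega>"
    using convex_imp_simply_connected homeomorphic_simply_connected_eq by blast
  moreover have "open ?\<Omega>"
    unfolding spiral_domain_def Collect_conj_eq
    by (intro open_Int open_Collect_less cg continuous_intros)
  moreover have "Complex ((g 0 + g (0 - 4 * pi)) / 2) 0 \<in> ?\<Omega>"
    using wd[of 0] by (simp add: spiral_domain_def)
  moreover have "0 \<notin> ?\<Omega>"
    using pos[of 0] by (simp add: spiral_domain_def)
  ultimately obtain p f where f: "f holomorphic_on ball 0 1"
      "\<forall>z\<in>?\<Omega>. p z \<in> ball 0 1 \<and> f (p z) = z" "\<forall>z\<in>ball 0 1. f z \<in> ?\<Omega> \<and> p (f z) = z"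
    using Riemann_mapping_theorem[of ?\<Omega>] by blast
  have "bij_betw f (ball 0 1) ?\<Omega>"
    by (rule bij_betw_byWitness[of _ p]) (use f in auto)
  with f(1) show thesis by (rule that)
qed

text \<open>Fibres of \<open>blaschke\<close> and of \<open>exp (- f)\<close> have at most two
  points each, the latter because \<open>f\<close> is injective. Surjectivity lifts a point through
  a nonzero Blaschke preimage, then the strip, then \<open>f\<close>.\<close>

lemma surj_four_valent_spiral_map:
  assumes f: "f holomorphic_on ball 0 1" "bij_betw f (ball 0 1) (spiral_domain g)"
    and mono: "\<And>y y'. y < y' \<Longrightarrow> g y' < g y" and surj: "\<And>x. x > 0 \<Longrightarrow> \<exists>y. g y = x"
    and pos: "\<And>y. g y > 0"
  shows "surj_four_valent_self_map (\<lambda>z. blaschke (exp (- f z)))"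
proof -
  let ?q = "\<lambda>z. exp (- f z)"
  have f_mem: "f z \<in> spiral_domain g" if "z \<in> ball 0 1" for z
    using f(2) that by (auto simp: bij_betw_def)
  have q_mem: "?q z \<in> ball 0 1" if "z \<in> ball 0 1" for z
  proof -
    have "0 < Re (f z)"
      using f_mem[OF that] pos[of "Im (f z)"] by (auto simp: spiral_domain_def)
    then show ?thesis by (simp add: norm_exp_eq_Re)
  qed
  have fib_b: "finite {v \<in> ball 0 1. blaschke v = w} \<and> card {v \<in> ball 0 1. blaschke v = w} \<le> 2" for w
  proof -
    obtain s t where "\<And>z. cmod z < 1 \<Longrightarrow> blaschke z = w \<longleftrightarrow> z = s \<or> z = t"
      using blaschke_roots[of w] by blast
    then show ?thesis by (intro card_le_2_of_subset[of _ s t]) auto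
  qed
  have fib_q: "finite {z \<in> ball 0 1. ?q z = v} \<and> card {z \<in> ball 0 1. ?q z = v} \<le> 2" for v
  proof (cases "{z \<in> ball 0 1. ?q z = v} = {}")
    case False
    then have "v \<noteq> 0" "cmod v < 1"
      using q_mem by auto
    then obtain u where u: "{w \<in> spiral_domain g. exp (- w) = v} \<subseteq> {u, u + 2 * pi * \<i>}"
      using spiral_domain_exp_fibre[OF mono surj] by metis
    have inj: "inj_on f {z \<in> ball 0 1. ?q z = v}"
      using f(2) by (auto simp: bij_betw_def intro: inj_on_subset)
    have "f ` {z \<in> ball 0 1. ?q z = v} \<subseteq> {u, u + 2 * pi * \<i>}"
      using u f_mem by auto
    from card_le_2_of_subset[OF this] show ?thesis
      using card_image[OF inj] finite_image_iff[OF inj] by simp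
  qed (simp only: finite.emptyI card.empty, simp)
  have "(\<lambda>z. blaschke (?q z)) holomorphic_on ball 0 1"
    unfolding blaschke_def using q_mem blaschke_denom_nonzero
    by (intro holomorphic_intros f) auto
  moreover have "(\<lambda>z. blaschke (?q z)) ` ball 0 1 = ball 0 1"
  proof
    show "(\<lambda>z. blaschke (?q z)) ` ball 0 1 \<subseteq> ball 0 1"
    proof
      fix w assume "w \<in> (\<lambda>z. blaschke (?q z)) ` ball 0 1"
      then obtain z where z: "z \<in> ball 0 1" "w = blaschke (?q z)" by blast
      have "cmod (?q z) < 1"
        using q_mem[OF z(1)] by (simp only: mem_ball_0)
      from norm_blaschke_le[OF this] this have "cmod w < 1"
        unfolding z(2) by (rule le_less_trans)
      then show "w \<in> ball 0 1" by simp
    qed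
    show "ball 0 1 \<subseteq> (\<lambda>z. blaschke (?q z)) ` ball 0 1"
    proof
      fix w :: complex assume "w \<in> ball 0 1"
      then obtain v where v: "cmod v < 1" "v \<noteq> 0" "blaschke v = w"
        using blaschke_preimage[of w] by auto
      obtain u where "u \<in> spiral_domain g" "exp (- u) = v"
        using spiral_domain_exp_fibre[OF mono surj v(2,1)] by metis
      moreover from this(1) obtain z where "z \<in> ball 0 1" "u = f z"
        using bij_betw_imp_surj_on[OF f(2)] by blast
      ultimately show "w \<in> (\<lambda>z. blaschke (?q z)) ` ball 0 1"
        using v(3) by blast
    qed
  qed
  moreover have "finite {z \<in> ball 0 1. blaschke (?q z) = w} \<and>
      card {z \<in> ball 0 1. blaschke (?q z) = w} \<le> 2 * 2" for w
    by (rule card_fibre_compose_le[OF fib_b fib_q]) (use q_mem in auto)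
  ultimately show ?thesis
    by (simp add: surj_four_valent_self_map_def)
qed

section \<open>The harmonic majorant and the tail estimate\<close>

text \<open>The real part of \<open>exp (- \<i> * w)\<close> is
  \<open>exp (Im w) * cos (Re w)\<close>. From height \<open>4 * pi\<close> upwards the strip is
  confined to \<open>0 < Re w < 1\<close>, where the cosine exceeds 1/2; below that height the added
  constant outweighs a possibly negative cosine.\<close>

lemma spiral_majorant:
  assumes mono: "\<And>y y'. y < y' \<Longrightarrow> g y' < g y" and g0: "g 0 \<le> 1" and pos: "\<And>y. g y > 0"
    and w: "w \<in> spiral_domain g"
  shows "exp (max 0 (Im w)) / 2 \<le> Re (2 * exp (4 * pi) + exp (- \<i> * w))"
proof -
  have Re: "Re (2 * exp (4 * pi) + exp (- \<i> * w)) = 2 * exp (4 * pi) + exp (Im w) * cos (Re w)"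
    by (simp add: Re_exp flip: exp_of_real)
  show ?thesis
  proof (cases "Im w < 4 * pi")
    case True
    have "exp (max 0 (Im w)) \<le> exp (4 * pi)"
      using True by simp
    moreover have "exp (Im w) * cos (Re w) \<ge> - exp (4 * pi)"
    proof -
      have "exp (Im w) * cos (Re w) \<ge> exp (Im w) * (- 1)"
        by (intro mult_left_mono) auto
      moreover have "exp (Im w) \<le> exp (4 * pi)" using True by simp
      ultimately show ?thesis by linarith
    qed
    moreover have "exp (4 * pi) > 0" by simp
    ultimately show ?thesis unfolding Re by linarith
  next
    case False
    have "0 < Re w"
      using w pos[of "Im w"] by (auto simp: spiral_domain_def)
    have "g (Im w - 4 * pi) \<le> g 0"
      using False mono[of 0 "Im w - 4 * pi"] by (cases "Im w = 4 * pi") auto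
    then have "Re w \<le> 1"
      using w g0 by (auto simp: spiral_domain_def)
    \<comment> \<open>Since \<open>pi > 3\<close>, the bound \<open>Re w \<le> 1\<close> stays below
      \<open>pi / 3\<close>.\<close>
    then have "cos (pi / 3) \<le> cos (Re w)"
      using \<open>0 < Re w\<close> pi_gt3 by (intro cos_monotone_0_pi_le) auto
    then have "exp (Im w) * (1 / 2) \<le> exp (Im w) * cos (Re w)"
      by (intro mult_left_mono) (auto simp: cos_60)
    moreover have "max 0 (Im w) = Im w" using False pi_gt_zero by linarith
    moreover have "exp (4 * pi) > 0" by simp
    ultimately show ?thesis unfolding Re by linarith
  qed
qed

lemma one_div_one_minus_exp_le:
  fixes x :: real
  assumes "x > 0"
  shows "1 / (1 - exp (- x)) \<le> 1 + 1 / x"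
proof -
  have "exp x \<ge> 1 + x" by (rule exp_ge_add_one_self)
  then have "exp (- x) \<le> 1 / (1 + x)"
    using assms by (simp add: exp_minus field_simps)
  also have "\<dots> = 1 - x / (1 + x)"
    using assms by (simp add: field_simps)
  finally have "x / (1 + x) \<le> 1 - exp (- x)" by simp
  then have "1 / (1 - exp (- x)) \<le> 1 / (x / (1 + x))"
    using assms by (intro divide_left_mono) auto
  then show ?thesis using assms by (simp add: field_simps)
qed

text \<open>The numerator costs \<open>exp (y / 2)\<close> through \<open>g_\<beta>\<close>, the
  denominator \<open>exp (y / 4)\<close> through \<open>g_exp\<close>. The total
  \<open>exp (3 * y / 4)\<close> is absorbed by the growth \<open>exp y\<close> of the
  majorant.\<close>

lemma spiral_tail_bound:
  assumes mono: "\<And>y y'. y < y' \<Longrightarrow> g y' < g y" and g0: "g 0 \<le> 1"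
    and g_exp: "\<And>y. g y \<ge> exp (- y / 4) / 2"
    and g_\<beta>: "\<And>N y. y \<ge> 0 \<Longrightarrow> \<beta> N - C - y / 4 \<le> real N * g y"
    and w: "w \<in> spiral_domain g" and v: "cmod v \<le> exp (- Re w)"
  shows "cmod v ^ (2 * N) / (1 - (cmod v)\<^sup>2)
     \<le> (2 * exp (C - \<beta> N))\<^sup>2 * Re (2 * exp (4 * pi) + exp (- \<i> * w))"
proof -
  have pos: "g y > 0" for y
    by (rule less_le_trans[OF _ g_exp]) simp
  \<comment> \<open>Clipped at 0 because \<open>g_\<beta>\<close> is available only for nonnegative
    arguments; as \<open>g\<close> decreases, \<open>g y\<close> still lies below
    \<open>Re w\<close>.\<close>
  define y where "y = max 0 (Im w)"
  have y0: "y \<ge> 0" by (simp add: y_def)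
  have "g y \<le> g (Im w)"
    using mono[of "Im w" y] by (cases "Im w < 0") (auto simp: y_def max_def)
  then have gy: "g y < Re w"
    using w by (simp add: spiral_domain_def)
  define \<rho> where "\<rho> = exp (- g y)"
  have v\<rho>: "cmod v \<le> \<rho>"
    using v gy by (simp add: \<rho>_def) (meson exp_le_cancel_iff le_less neg_le_iff_le order_trans)
  have \<rho>2: "\<rho>\<^sup>2 = exp (- (2 * g y))"
    by (simp add: \<rho>_def power2_eq_square flip: exp_add)
  have \<rho>1: "\<rho>\<^sup>2 < 1"
    using pos[of y] by (simp add: \<rho>2)
  have "(cmod v)\<^sup>2 \<le> \<rho>\<^sup>2"
    using v\<rho> by (intro power_mono) auto
  then have "cmod v ^ (2 * N) / (1 - (cmod v)\<^sup>2) \<le> \<rho> ^ (2 * N) / (1 - \<rho>\<^sup>2)"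
    using v\<rho> \<rho>1 by (intro frac_le power_mono) (auto simp: \<rho>_def)
  also have "\<dots> = exp (- 2 * (real N * g y)) * (1 / (1 - exp (- (2 * g y))))"
    by (simp add: \<rho>2 power_mult) (simp add: mult_ac flip: exp_of_nat_mult)
  also have "\<dots> \<le> exp (- 2 * (\<beta> N - C - y / 4)) * (2 * exp (y / 4))"
  proof (intro mult_mono)
    show "exp (- 2 * (real N * g y)) \<le> exp (- 2 * (\<beta> N - C - y / 4))"
      using g_\<beta>[OF y0, of N] by simp
    have "1 / (1 - exp (- (2 * g y))) \<le> 1 + 1 / (2 * g y)"
      using pos[of y] by (intro one_div_one_minus_exp_le) simp
    also have "1 / (2 * g y) \<le> 1 / exp (- y / 4)"
      using g_exp[of y] pos[of y] by (intro divide_left_mono) auto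
    also have "1 / exp (- y / 4) = exp (y / 4)"
      by (simp add: exp_minus field_simps)
    also have "1 + exp (y / 4) \<le> 2 * exp (y / 4)"
      using y0 by simp
    finally show "1 / (1 - exp (- (2 * g y))) \<le> 2 * exp (y / 4)" by simp
  qed (use pos[of y] in auto)
  also have "\<dots> = 2 * (exp (C - \<beta> N))\<^sup>2 * exp (3 * y / 4)"
    by (simp add: power2_eq_square algebra_simps flip: exp_add)
  also have "\<dots> \<le> 2 * (exp (C - \<beta> N))\<^sup>2 * exp y"
    using y0 by (intro mult_left_mono) auto
  \<comment> \<open>The factor 2 is rewritten as 4/2 to match the \<open>exp y / 2\<close> of the
    majorant.\<close>
  also have "\<dots> = (2 * exp (C - \<beta> N))\<^sup>2 * (exp y / 2)"
    by (simp add: power_mult_distrib)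
  also have "\<dots> \<le> (2 * exp (C - \<beta> N))\<^sup>2 * Re (2 * exp (4 * pi) + exp (- \<i> * w))"
    unfolding y_def by (intro mult_left_mono spiral_majorant[OF mono g0 pos w]) auto
  finally show ?thesis .
qed

section \<open>Prescribed decay and Schatten classes\<close>

text \<open>Nonnegativity is recorded alongside the decay because taking powers with
  \<open>powr\<close> in the Schatten sum requires it.\<close>

lemma exists_four_valent_fast_decay:
  fixes \<epsilon> :: "nat \<Rightarrow> real"
  assumes \<epsilon>: "\<epsilon> \<longlonglongrightarrow> 0"
  obtains \<phi> K where "surj_four_valent_self_map \<phi>" "K > 0"
    "\<And>n. n \<ge> 1 \<Longrightarrow> 0 \<le> approx_num (comp_op \<phi>) n"
    "\<And>n. n \<ge> 1 \<Longrightarrow> approx_num (comp_op \<phi>) n \<le> K * exp (- real n * \<epsilon> n)"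
proof -
  \<comment> \<open>The shift accounts for the rank bound \<open>n - 1\<close>: truncating there
    yields the exponent \<open>\<beta> (n - 1) = n * \<epsilon> n\<close>.\<close>
  define \<beta> where "\<beta> N = real (Suc N) * \<epsilon> (Suc N)" for N
  have "(\<lambda>N. (1 + 1 / real N) * \<epsilon> (Suc N)) \<longlonglongrightarrow> (1 + 0) * 0"
    by (intro tendsto_intros lim_1_over_n LIMSEQ_Suc \<epsilon>)
  moreover have "\<forall>\<^sub>F N in sequentially. (1 + 1 / real N) * \<epsilon> (Suc N) = \<beta> N / real N"
    using eventually_gt_at_top[of 0] by eventually_elim (simp add: \<beta>_def field_simps)
  ultimately have "(\<lambda>N. \<beta> N / real N) \<longlonglongrightarrow> 0"
    using Lim_transform_eventually by fastforce
  then obtain g C where g: "continuous_on UNIV g" "\<And>y y'. y < y' \<Longrightarrow> g y' < g y"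
    "\<And>x. x > 0 \<Longrightarrow> \<exists>y. g y = x" "g 0 \<le> 1" "\<And>y. g y \<ge> exp (- y / 4) / 2"
    "\<And>N y. y \<ge> 0 \<Longrightarrow> \<beta> N - C - y / 4 \<le> real N * g y"
    by (rule exists_slow_profile) blast
  have pos: "g y > 0" for y
    by (rule less_le_trans[OF _ g(5)]) simp
  obtain f where f: "f holomorphic_on ball 0 1" "bij_betw f (ball 0 1) (spiral_domain g)"
    using spiral_domain_riemann_map[OF g(1,2) pos] by blast
  have f_mem: "f z \<in> spiral_domain g" if "z \<in> ball 0 1" for z
    using f(2) that by (auto simp: bij_betw_def)
  define \<phi> where "\<phi> z = blaschke (exp (- f z))" for z
  define h where "h z = 2 * exp (4 * pi) + exp (- \<i> * f z)" for z
  define K where "K = 2 * exp C * sqrt (Re (h 0))"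
  have \<phi>: "surj_four_valent_self_map \<phi>"
    unfolding \<phi>_def[abs_def] by (rule surj_four_valent_spiral_map[OF f g(2,3) pos])
  have norm_\<phi>: "cmod (\<phi> z) \<le> exp (- Re (f z))" if "z \<in> ball 0 1" for z
  proof -
    have "Re (f z) > 0"
      using f_mem[OF that] pos[of "Im (f z)"] by (auto simp: spiral_domain_def)
    then show ?thesis
      using norm_blaschke_le[of "exp (- f z)"] by (simp add: \<phi>_def norm_exp_eq_Re)
  qed
  have h: "h holomorphic_on ball 0 1"
    unfolding h_def[abs_def] by (intro holomorphic_intros f)
  have tail: "cmod (\<phi> z) ^ (2 * (n - 1)) / (1 - (cmod (\<phi> z))\<^sup>2)
      \<le> (2 * exp (C - \<beta> (n - 1)))\<^sup>2 * Re (h z)" if "z \<in> ball 0 1" for z n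
    unfolding h_def by (rule spiral_tail_bound[OF g(2,4,5,6) f_mem[OF that] norm_\<phi>[OF that]])
  have bounds: "0 \<le> approx_num (comp_op \<phi>) n"
    "approx_num (comp_op \<phi>) n \<le> 2 * exp (C - \<beta> (n - 1)) * sqrt (Re (h 0))" for n
    using approx_num_comp_op_bounds[OF _ _ h _ tail] \<phi>
    by (auto simp: surj_four_valent_self_map_def)
  show thesis
  proof (rule that[OF \<phi>])
    have "0 < exp (max 0 (Im (f 0))) / 2" by simp
    also have "\<dots> \<le> Re (h 0)"
      unfolding h_def by (rule spiral_majorant[of g]) (simp_all add: f_mem g pos)
    finally show "K > 0" by (simp add: K_def)
    fix n :: nat assume "n \<ge> 1"
    show "0 \<le> approx_num (comp_op \<phi>) n" by (rule bounds)
    have "exp (C - \<beta> (n - 1)) = exp C * exp (- real n * \<epsilon> n)"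
      using \<open>n \<ge> 1\<close> by (simp add: \<beta>_def flip: exp_add)
    then show "approx_num (comp_op \<phi>) n \<le> K * exp (- real n * \<epsilon> n)"
      using bounds(2)[of n] by (simp add: K_def mult_ac)
  qed
qed

lemma summable_exp_neg_sqrt:
  fixes p :: real
  assumes "p > 0"
  shows "summable (\<lambda>n. exp (- p * sqrt (real (Suc n))))"
proof (rule summable_comparison_test_bigo)
  show "summable (\<lambda>n. norm (1 / real n ^ 2))"
    using inverse_power_summable[of 2, where 'a = real] by (simp add: inverse_eq_divide)
  show "(\<lambda>n. exp (- p * sqrt (real (Suc n)))) \<in> O(\<lambda>n. 1 / real n ^ 2)"
    using assms by real_asymp
qed

theorem theorem3p2:
  shows "(\<forall>\<epsilon> :: nat \<Rightarrow> real. (\<forall>n\<ge>1. \<epsilon> n > 0) \<and> \<epsilon> \<longlonglongrightarrow> 0 \<longrightarrow>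
            (\<exists>\<phi>. surj_four_valent_self_map \<phi> \<and>
               (\<exists>K>0. \<forall>n\<ge>1. approx_num (comp_op \<phi>) n \<le> K * exp (- real n * \<epsilon> n))))
       \<and> (\<exists>\<phi>. surj_four_valent_self_map \<phi> \<and> (\<forall>p>0. schatten p (comp_op \<phi>)))"
proof
  show "\<forall>\<epsilon> :: nat \<Rightarrow> real. (\<forall>n\<ge>1. \<epsilon> n > 0) \<and> \<epsilon> \<longlonglongrightarrow> 0 \<longrightarrow>
            (\<exists>\<phi>. surj_four_valent_self_map \<phi> \<and>
               (\<exists>K>0. \<forall>n\<ge>1. approx_num (comp_op \<phi>) n \<le> K * exp (- real n * \<epsilon> n)))"
    using exists_four_valent_fast_decay by metis
next
  \<comment> \<open>With \<open>1 / sqrt n\<close> as the null sequence the bound is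
    \<open>K * exp (- sqrt n)\<close>. Every positive power of it is summable, so a single map
    serves all \<open>p\<close>.\<close>
  have "(\<lambda>n. 1 / sqrt (real n)) \<longlonglongrightarrow> 0"
    by real_asymp
  then obtain \<phi> K where \<phi>: "surj_four_valent_self_map \<phi>" and K: "K > 0"
    "\<And>n. n \<ge> 1 \<Longrightarrow> 0 \<le> approx_num (comp_op \<phi>) n"
    "\<And>n. n \<ge> 1 \<Longrightarrow> approx_num (comp_op \<phi>) n \<le> K * exp (- real n * (1 / sqrt (real n)))"
    using exists_four_valent_fast_decay by metis
  have "schatten p (comp_op \<phi>)" if "p > 0" for p
    unfolding schatten_def
  proof (rule summable_comparison_test'[where N = 0])
    show "summable (\<lambda>n. K powr p * exp (- p * sqrt (real (Suc n))))"
      by (intro summable_mult summable_exp_neg_sqrt that)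
    fix n :: nat
    have "- real (Suc n) * (1 / sqrt (real (Suc n))) = - sqrt (real (Suc n))"
      by (simp add: real_div_sqrt del: of_nat_Suc)
    then have "approx_num (comp_op \<phi>) (Suc n) \<le> K * exp (- sqrt (real (Suc n)))"
      using K(3)[of "Suc n"] by simp
    then have "approx_num (comp_op \<phi>) (Suc n) powr p \<le> (K * exp (- sqrt (real (Suc n)))) powr p"
      using K(2)[of "Suc n"] that by (intro powr_mono2) auto
    also have "\<dots> = K powr p * exp (- p * sqrt (real (Suc n)))"
      using K(1) by (simp add: powr_mult powr_def[of "exp _"])
    finally show "norm (approx_num (comp_op \<phi>) (Suc n) powr p) \<le> K powr p * exp (- p * sqrt (real (Suc n)))"
      by simp
  qed
  with \<phi> show "\<exists>\<phi>. surj_four_valent_self_map \<phi> \<and> (\<forall>p>0. schatten p (comp_op \<phi>))"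
    by (intro exI[of _ \<phi>]) simp
qed

end
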